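(* Let $A=\sigma(R)\langle x_1,\dots,x_n\rangle$ be a skew PBW extension of a ring $R$ with associated family of endomorphisms $\Sigma=\{\sigma_1,\dots,\sigma_n\}$ and family of $\Sigma$-derivations $\Delta=\{\delta_1,\dots,\delta_n\}$, and assume that the elements $c_{i,j}$ (with $x_jx_i-c_{i,j}x_ix_j\in R+Rx_1+\cdots+Rx_n$) are central in $R$. If $R$ is $\Sigma$-compatible and $\Sigma$-skew Armendariz, then $R$ is skew $\Pi$-Armendariz (with respect to $A$).
   Context: Rings are associative with unity, not necessarily commutative; $\mathrm{nil}(B)$ is the set of nilpotent elements of a ring $B$. Skew PBW extension ($\sigma$-PBW extension): $A=\sigma(R)\langle x_1,\dots,x_n\rangle$ is a skew PBW extension of $R$ if (i) $R\subseteq A$ is a subring; (ii) there are $x_1,\dots,x_n\in A$ such that $A$ is a free left $R$-module with basis $\mathrm{Mon}(A)=\{x^\alpha=x_1^{\alpha_1}\cdots x_n^{\alpha_n}\mid \alpha\in\mathbb N^n\}$, with $x_1^0\cdots x_n^0=1$; (iii) for each $1\le i\le n$ and $r\in R\setminus\{0\}$ there is $c_{i,r}\in R\setminus\{0\}$ with $x_ir-c_{i,r}x_i\in R$; (iv) for all $1\le i,j\le n$ there is $c_{i,j}\in R\setminus\{0\}$ with $x_jx_i-c_{i,j}x_ix_j\in R+Rx_1+\cdots+Rx_n$. It is known that for each $i$ there are an injective ring endomorphism $\sigma_i:R\to R$ and a $\sigma_i$-derivation $\delta_i:R\to R$ (additive, $\delta_i(rs)=\sigma_i(r)\delta_i(s)+\delta_i(r)s$)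 with $x_ir=\sigma_i(r)x_i+\delta_i(r)$ for all $r\in R$; $\Sigma=\{\sigma_1,\dots,\sigma_n\}$ and $\Delta=\{\delta_1,\dots,\delta_n\}$ are these families. For $\alpha\in\mathbb N^n$, $\sigma^\alpha=\sigma_1^{\alpha_1}\cdots\sigma_n^{\alpha_n}$ (composition). $R$ is $\Sigma$-compatible if for all $a,b\in R$ and all $\alpha\in\mathbb N^n$: $a\sigma^\alpha(b)=0\iff ab=0$. Elements of $A$ are written $f=\sum_{i=0}^m a_iX_i$ with $a_i\in R$, $X_0=1$, and $X_0,X_1,\dots,X_m$ distinct elements of $\mathrm{Mon}(A)$. For $X=x^\alpha$, $\exp(X)=\alpha$. $\Sigma$-skew Armendariz: $R$ is $\Sigma$-skew Armendariz if for all $f=\sum_{i=0}^m a_iX_i$, $g=\sum_{j=0}^t b_jY_j$ in $A$ with $fg=0$, one has $a_i\sigma^{\alpha_i}(b_j)=0$ for all $0\le i\le m$, $0\le j\le t$, where $\alpha_i=\exp(X_i)$. Skew $\Pi$-Armendariz: $R$ is skew $\Pi$-Armendariz (with respect to $A$) if for all $f=\sum_{i=0}^m a_iX_i$ and $g=\sum_{j=0}^t b_jY_j$ in $A$, $fg\in\mathrm{nil}(A)$ implies $a_ib_j\in\mathrm{nil}(R)$ for all $0\le i\le m$, $0\le j\le t$. *)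

theory Defs
  imports Main
begin

text \<open>
  The ring \<open>A\<close> is the whole type \<open>'a\<close>; the coefficient ring is a subset \<open>R\<close> of it.  The class
  \<open>ring_1\<close> has \<open>0 \<noteq> 1\<close>; this excludes no skew PBW extension in \<open>n \<ge> 1\<close> variables, because the
  axioms ask for nonzero constants \<open>c\<^sub>i\<^sub>,\<^sub>j\<close>.  The variables \<open>x\<^sub>1, \<dots>, x\<^sub>n\<close> and everything indexed
  by them are numbered from \<open>0\<close> to \<open>n - 1\<close>.
\<close>

definition unital_subring :: "'a::ring_1 set \<Rightarrow> bool" where
  "unital_subring R \<longleftrightarrow>
     1 \<in> R \<and> (\<forall>a\<in>R. \<forall>b\<in>R. a - b \<in> R) \<and> (\<forall>a\<in>R. \<forall>b\<in>R. a * b \<in> R)"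

definition nilpotents :: "'a::ring_1 set \<Rightarrow> 'a set" where
  "nilpotents B = {b \<in> B. \<exists>k>0. b ^ k = 0}"

definition central_in :: "'a::ring_1 set \<Rightarrow> 'a \<Rightarrow> bool" where
  "central_in R c \<longleftrightarrow> c \<in> R \<and> (\<forall>r\<in>R. c * r = r * c)"

text \<open>The exponents in \<open>\<nat>\<^sup>n\<close> are the functions that vanish from \<open>n\<close> on.\<close>

definition exponents :: "nat \<Rightarrow> (nat \<Rightarrow> nat) set" where
  "exponents n = {\<alpha>. \<forall>i\<ge>n. \<alpha> i = 0}"

text \<open>The factors do not commute: the product is taken in the order of increasing index.\<close>

definition monom_of :: "nat \<Rightarrow> (nat \<Rightarrow> 'a::ring_1) \<Rightarrow> (nat \<Rightarrow> nat) \<Rightarrow> 'a" where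
  "monom_of n x \<alpha> = prod_list (map (\<lambda>i. x i ^ \<alpha> i) [0..<n])"

definition Mon :: "nat \<Rightarrow> (nat \<Rightarrow> 'a::ring_1) \<Rightarrow> 'a set" where
  "Mon n x = monom_of n x ` exponents n"

text \<open>
  \<open>A\<close> is a free left \<open>R\<close>-module with basis the family of the \<open>x\<^sup>\<alpha>\<close>, indexed by \<open>\<alpha>\<close>; in particular
  different exponents give different monomials.
\<close>

definition monomial_basis :: "'a::ring_1 set \<Rightarrow> nat \<Rightarrow> (nat \<Rightarrow> 'a) \<Rightarrow> bool" where
  "monomial_basis R n x \<longleftrightarrow>
     (\<forall>f. \<exists>S a. finite S \<and> S \<subseteq> exponents n \<and> (\<forall>\<alpha>\<in>S. a \<alpha> \<in> R) \<and>
            f = (\<Sum>\<alpha>\<in>S. a \<alpha> * monom_of n x \<alpha>)) \<and>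
     (\<forall>S a. finite S \<and> S \<subseteq> exponents n \<and> (\<forall>\<alpha>\<in>S. a \<alpha> \<in> R) \<and>
            (\<Sum>\<alpha>\<in>S. a \<alpha> * monom_of n x \<alpha>) = 0 \<longrightarrow> (\<forall>\<alpha>\<in>S. a \<alpha> = 0))"

text \<open>The set \<open>R + R x\<^sub>1 + \<dots> + R x\<^sub>n\<close>.\<close>

definition linear_part :: "'a::ring_1 set \<Rightarrow> nat \<Rightarrow> (nat \<Rightarrow> 'a) \<Rightarrow> 'a set" where
  "linear_part R n x = {r + (\<Sum>k<n. s k * x k) | r s. r \<in> R \<and> (\<forall>k<n. s k \<in> R)}"

text \<open>\<open>d\<close> is admissible as the constant \<open>c\<^sub>i\<^sub>,\<^sub>j\<close>.\<close>

definition commutation_constant ::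
    "'a::ring_1 set \<Rightarrow> nat \<Rightarrow> (nat \<Rightarrow> 'a) \<Rightarrow> nat \<Rightarrow> nat \<Rightarrow> 'a \<Rightarrow> bool" where
  "commutation_constant R n x i j d \<longleftrightarrow>
     d \<in> R - {0} \<and> x j * x i - d * x i * x j \<in> linear_part R n x"

definition skew_PBW_extension :: "'a::ring_1 set \<Rightarrow> nat \<Rightarrow> (nat \<Rightarrow> 'a) \<Rightarrow> bool" where
  "skew_PBW_extension R n x \<longleftrightarrow>
     unital_subring R \<and>
     monomial_basis R n x \<and>
     (\<forall>i<n. \<forall>r\<in>R - {0}. \<exists>d\<in>R - {0}. x i * r - d * x i \<in> R) \<and>
     (\<forall>i<n. \<forall>j<n. \<exists>d. commutation_constant R n x i j d)"

definition ring_endomorphism_on :: "'a::ring_1 set \<Rightarrow> ('a \<Rightarrow> 'a) \<Rightarrow> bool" where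
  "ring_endomorphism_on R \<sigma> \<longleftrightarrow>
     (\<forall>r\<in>R. \<sigma> r \<in> R) \<and> \<sigma> 1 = 1 \<and>
     (\<forall>r\<in>R. \<forall>s\<in>R. \<sigma> (r + s) = \<sigma> r + \<sigma> s) \<and>
     (\<forall>r\<in>R. \<forall>s\<in>R. \<sigma> (r * s) = \<sigma> r * \<sigma> s)"

definition skew_derivation_on :: "'a::ring_1 set \<Rightarrow> ('a \<Rightarrow> 'a) \<Rightarrow> ('a \<Rightarrow> 'a) \<Rightarrow> bool" where
  "skew_derivation_on R \<sigma> \<delta> \<longleftrightarrow>
     (\<forall>r\<in>R. \<delta> r \<in> R) \<and>
     (\<forall>r\<in>R. \<forall>s\<in>R. \<delta> (r + s) = \<delta> r + \<delta> s) \<and>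
     (\<forall>r\<in>R. \<forall>s\<in>R. \<delta> (r * s) = \<sigma> r * \<delta> s + \<delta> r * s)"

text \<open>
  The families \<open>\<Sigma>\<close> and \<open>\<Delta>\<close> of a skew PBW extension.  By freeness the last condition determines
  each \<open>\<sigma> i\<close> and \<open>\<delta> i\<close> on \<open>R\<close>; their values outside \<open>R\<close> are irrelevant.
\<close>

definition associated_families ::
    "'a::ring_1 set \<Rightarrow> nat \<Rightarrow> (nat \<Rightarrow> 'a) \<Rightarrow> (nat \<Rightarrow> 'a \<Rightarrow> 'a) \<Rightarrow> (nat \<Rightarrow> 'a \<Rightarrow> 'a) \<Rightarrow> bool" where
  "associated_families R n x \<sigma> \<delta> \<longleftrightarrow>
     (\<forall>i<n. ring_endomorphism_on R (\<sigma> i) \<and> inj_on (\<sigma> i) R \<and>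
            skew_derivation_on R (\<sigma> i) (\<delta> i) \<and>
            (\<forall>r\<in>R. x i * r = \<sigma> i r * x i + \<delta> i r))"

text \<open>\<open>\<sigma>\<^sup>\<alpha>\<close> as a composition, the map with the largest index being applied first.\<close>

definition endo_power :: "nat \<Rightarrow> (nat \<Rightarrow> 'a \<Rightarrow> 'a) \<Rightarrow> (nat \<Rightarrow> nat) \<Rightarrow> 'a \<Rightarrow> 'a" where
  "endo_power n \<sigma> \<alpha> = foldr (\<circ>) (map (\<lambda>i. \<sigma> i ^^ \<alpha> i) [0..<n]) id"

definition Sigma_compatible :: "'a::ring_1 set \<Rightarrow> nat \<Rightarrow> (nat \<Rightarrow> 'a \<Rightarrow> 'a) \<Rightarrow> bool" where
  "Sigma_compatible R n \<sigma> \<longleftrightarrow>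
     (\<forall>a\<in>R. \<forall>b\<in>R. \<forall>\<alpha>\<in>exponents n. a * endo_power n \<sigma> \<alpha> b = 0 \<longleftrightarrow> a * b = 0)"

definition exp_of :: "nat \<Rightarrow> (nat \<Rightarrow> 'a::ring_1) \<Rightarrow> 'a \<Rightarrow> (nat \<Rightarrow> nat)" where
  "exp_of n x X = (THE \<alpha>. \<alpha> \<in> exponents n \<and> X = monom_of n x \<alpha>)"

text \<open>
  The expressions \<open>f = a\<^sub>0 X\<^sub>0 + \<dots> + a\<^sub>m X\<^sub>m\<close> with \<open>X\<^sub>0 = 1\<close> and distinct monomials; coefficients may
  be zero, so an element has many such expressions.
\<close>

definition has_expression ::
    "'a::ring_1 set \<Rightarrow> nat \<Rightarrow> (nat \<Rightarrow> 'a) \<Rightarrow> 'a \<Rightarrow> nat \<Rightarrow> (nat \<Rightarrow> 'a) \<Rightarrow> (nat \<Rightarrow> 'a) \<Rightarrow> bool" where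
  "has_expression R n x f m a X \<longleftrightarrow>
     (\<forall>i\<le>m. a i \<in> R) \<and> (\<forall>i\<le>m. X i \<in> Mon n x) \<and> X 0 = 1 \<and> inj_on X {..m} \<and>
     f = (\<Sum>i\<le>m. a i * X i)"

definition Sigma_skew_Armendariz ::
    "'a::ring_1 set \<Rightarrow> nat \<Rightarrow> (nat \<Rightarrow> 'a) \<Rightarrow> (nat \<Rightarrow> 'a \<Rightarrow> 'a) \<Rightarrow> bool" where
  "Sigma_skew_Armendariz R n x \<sigma> \<longleftrightarrow>
     (\<forall>f g m t a b X Y.
        has_expression R n x f m a X \<and> has_expression R n x g t b Y \<and> f * g = 0 \<longrightarrow>
        (\<forall>i\<le>m. \<forall>j\<le>t. a i * endo_power n \<sigma> (exp_of n x (X i)) (b j) = 0))"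

definition skew_Pi_Armendariz :: "'a::ring_1 set \<Rightarrow> nat \<Rightarrow> (nat \<Rightarrow> 'a) \<Rightarrow> bool" where
  "skew_Pi_Armendariz R n x \<longleftrightarrow>
     (\<forall>f g m t a b X Y.
        has_expression R n x f m a X \<and> has_expression R n x g t b Y \<and>
        f * g \<in> nilpotents UNIV \<longrightarrow>
        (\<forall>i\<le>m. \<forall>j\<le>t. a i * b j \<in> nilpotents R))"

end

theory Submission
  imports Defs
begin

text \<open>
  If \<open>f g = 0\<close>, the Armendariz condition and compatibility give \<open>a\<^sub>i b\<^sub>j = 0\<close> for all coefficients,
  so that \<open>a\<^sub>i g = 0\<close>: a left factor may be replaced by any of its coefficients.  Since left
  multiplication by \<open>R\<close> acts coefficientwise, this can be repeated from left to right along
  \<open>f g f g \<cdots> f g = 0\<close> and ends in \<open>(a\<^sub>i b\<^sub>j)\<^sup>k = 0\<close>.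
\<close>

lemma unital_subring_closed:
  assumes "unital_subring R"
  shows "1 \<in> R" "0 \<in> R" "- 1 \<in> R" and "a \<in> R \<Longrightarrow> b \<in> R \<Longrightarrow> a * b \<in> R"
proof -
  have minus: "a - b \<in> R" if "a \<in> R" "b \<in> R" for a b
    using assms that by (simp add: unital_subring_def)
  show one: "1 \<in> R"
    using assms by (simp add: unital_subring_def)
  show zero: "0 \<in> R"
    using minus[OF one one] by simp
  show "- 1 \<in> R"
    using minus[OF zero one] by simp
  show "a \<in> R \<Longrightarrow> b \<in> R \<Longrightarrow> a * b \<in> R"
    using assms by (simp add: unital_subring_def)
qed

lemma monom_of_zero: "monom_of n x (\<lambda>_. 0) = 1"
proof -
  have "prod_list (map (\<lambda>i. x i ^ 0) is) = 1" for "is"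
    by (induction "is") auto
  then show ?thesis
    by (simp add: monom_of_def)
qed

text \<open>If two exponents gave the same monomial, the coefficients \<open>1\<close> and
  \<open>- 1\<close> would form a nontrivial relation, against freeness since \<open>1\<close> is
  nonzero.\<close>

lemma inj_on_monom_of:
  assumes "unital_subring R" and "monomial_basis R n x"
  shows "inj_on (monom_of n x) (exponents n)"
proof (rule inj_onI, rule ccontr)
  fix \<alpha> \<beta>
  assume exps: "\<alpha> \<in> exponents n" "\<beta> \<in> exponents n"
    and eq: "monom_of n x \<alpha> = monom_of n x \<beta>" and "\<alpha> \<noteq> \<beta>"
  define a :: "(nat \<Rightarrow> nat) \<Rightarrow> 'a" where "a \<gamma> = (if \<gamma> = \<alpha> then 1 else - 1)" for \<gamma>
  have "(\<Sum>\<gamma>\<in>{\<alpha>, \<beta>}. a \<gamma> * monom_of n x \<gamma>) = 0"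
    using \<open>\<alpha> \<noteq> \<beta>\<close> eq by (simp add: a_def)
  moreover have "\<forall>\<gamma>\<in>{\<alpha>, \<beta>}. a \<gamma> \<in> R"
    using unital_subring_closed[OF assms(1)] by (simp add: a_def)
  moreover have "finite {\<alpha>, \<beta>}" "{\<alpha>, \<beta>} \<subseteq> exponents n"
    using exps by auto
  ultimately have "\<forall>\<gamma>\<in>{\<alpha>, \<beta>}. a \<gamma> = 0"
    using assms(2) unfolding monomial_basis_def by blast
  then show False
    by (simp add: a_def)
qed

text \<open>Injectivity makes the exponent of a monomial unique, so the definite description in
  \<open>exp_of\<close> denotes it.\<close>

lemma exp_of_in_exponents:
  assumes "inj_on (monom_of n x) (exponents n)" and "X \<in> Mon n x"
  shows "exp_of n x X \<in> exponents n"
proof -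
  have "\<exists>!\<alpha>. \<alpha> \<in> exponents n \<and> X = monom_of n x \<alpha>"
    using assms by (auto simp: Mon_def inj_on_def)
  from theI'[OF this] show ?thesis
    by (simp add: exp_of_def)
qed

text \<open>A basis expansion need not involve the monomial \<open>1\<close>, whereas an expression
  must have it at index \<open>0\<close>. The zero exponent is therefore put in front, with
  coefficient \<open>0\<close> if it was absent.\<close>

lemma has_expression_exists:
  assumes "unital_subring R" and "monomial_basis R n x"
  obtains m a X where "has_expression R n x f m a X"
proof -
  obtain S b where S: "finite S" "S \<subseteq> exponents n" and b: "\<forall>\<alpha>\<in>S. b \<alpha> \<in> R"
    and f: "f = (\<Sum>\<alpha>\<in>S. b \<alpha> * monom_of n x \<alpha>)"
    using assms(2) unfolding monomial_basis_def by blast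
  define z :: "nat \<Rightarrow> nat" where "z = (\<lambda>_. 0)"
  define d where "d \<alpha> = (if \<alpha> \<in> S then b \<alpha> else 0)" for \<alpha>
  define m where "m = card (S - {z})"
  obtain h where h: "bij_betw h {..<m} (S - {z})"
    using ex_bij_betw_nat_finite[of "S - {z}"] S(1) by (auto simp: m_def atLeast0LessThan)
  \<comment> \<open>Index \<open>0\<close> is reserved for \<open>z\<close>; the \<open>m\<close>
    other exponents of \<open>S\<close>, enumerated by \<open>h\<close> from \<open>0\<close>, move
    up by one.\<close>
  define e where "e i = (case i of 0 \<Rightarrow> z | Suc j \<Rightarrow> h j)" for i
  have inj: "inj_on e {..m}"
    using h by (force simp: inj_on_def bij_betw_def e_def split: nat.splits)
  have img: "e ` {..m} = insert z S"
  proof -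
    have "{..m} = insert 0 (Suc ` {..<m})"
      unfolding lessThan_Suc_atMost[symmetric] by (rule lessThan_Suc_eq_insert_0)
    then have "e ` {..m} = insert z (h ` {..<m})"
      by (simp add: e_def image_image)
    also have "h ` {..<m} = S - {z}"
      using h by (simp add: bij_betw_def)
    finally show ?thesis
      by simp
  qed
  have exps: "e i \<in> exponents n" if "i \<le> m" for i
  proof -
    have "e i \<in> insert z S"
      using img that by blast
    then show ?thesis
      using S(2) by (auto simp: exponents_def z_def)
  qed
  have "f = (\<Sum>\<alpha>\<in>insert z S. d \<alpha> * monom_of n x \<alpha>)"
    unfolding f using S(1) by (intro sum.mono_neutral_cong_left) (auto simp: d_def)
  also have "\<dots> = (\<Sum>i\<le>m. d (e i) * monom_of n x (e i))"
    using sum.reindex[OF inj, of "\<lambda>\<alpha>. d \<alpha> * monom_of n x \<alpha>"] img by simp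
  finally have "f = (\<Sum>i\<le>m. d (e i) * monom_of n x (e i))" .
  moreover have "inj_on (\<lambda>i. monom_of n x (e i)) {..m}"
    using inj exps inj_on_monom_of[OF assms] by (auto simp: inj_on_def)
  moreover have "monom_of n x (e 0) = 1"
    by (simp add: e_def z_def monom_of_zero)
  moreover have "d \<alpha> \<in> R" for \<alpha>
    using b unital_subring_closed(2)[OF assms(1)] by (simp add: d_def)
  ultimately have "has_expression R n x f m (\<lambda>i. d (e i)) (\<lambda>i. monom_of n x (e i))"
    using exps by (auto simp: has_expression_def Mon_def)
  then show thesis
    by (rule that)
qed

lemma has_expression_left_mult:
  assumes "unital_subring R" and "r \<in> R" and "has_expression R n x f m a X"
  shows "has_expression R n x (r * f) m (\<lambda>i. r * a i) X"
  using assms unital_subring_closed(4)[OF assms(1)]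
  by (auto simp: has_expression_def sum_distrib_left mult.assoc)

text \<open>Apply the Armendariz condition to any expression of \<open>g\<close>; compatibility
  removes the endomorphisms, and the products \<open>a i * b j = 0\<close> sum up to
  \<open>a i * g = 0\<close>. As \<open>g\<close> is arbitrary, it may be the whole tail of a longer
  product.\<close>

lemma coefficient_mult_eq_0:
  assumes "unital_subring R" and "monomial_basis R n x"
    and "Sigma_compatible R n \<sigma>" and "Sigma_skew_Armendariz R n x \<sigma>"
    and f: "has_expression R n x f m a X" and "f * g = 0" and "i \<le> m"
  shows "a i * g = 0"
proof -
  obtain t b Y where g: "has_expression R n x g t b Y"
    using has_expression_exists[OF assms(1,2)] by blast
  have "exp_of n x (X i) \<in> exponents n"
    using exp_of_in_exponents[OF inj_on_monom_of[OF assms(1,2)]] f \<open>i \<le> m\<close>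
    by (simp add: has_expression_def)
  moreover have "a i * endo_power n \<sigma> (exp_of n x (X i)) (b j) = 0" if "j \<le> t" for j
    using assms(4) f g \<open>f * g = 0\<close> \<open>i \<le> m\<close> that unfolding Sigma_skew_Armendariz_def by blast
  ultimately have "a i * b j = 0" if "j \<le> t" for j
    using assms(3) f g \<open>i \<le> m\<close> that by (auto simp: Sigma_compatible_def has_expression_def)
  then have "(\<Sum>j\<le>t. a i * b j * Y j) = 0"
    by simp
  then show ?thesis
    using g by (simp add: has_expression_def sum_distrib_left mult.assoc)
qed

theorem proposition3p5:
  fixes R :: "'a::ring_1 set"
    and n :: nat
    and x :: "nat \<Rightarrow> 'a"
    and c :: "nat \<Rightarrow> nat \<Rightarrow> 'a"
    and \<sigma> \<delta> :: "nat \<Rightarrow> 'a \<Rightarrow> 'a"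
  assumes "skew_PBW_extension R n x"
    and "associated_families R n x \<sigma> \<delta>"
    and "\<And>i j. i < n \<Longrightarrow> j < n \<Longrightarrow> commutation_constant R n x i j (c i j)"
    and "\<And>i j. i < n \<Longrightarrow> j < n \<Longrightarrow> central_in R (c i j)"
    and "Sigma_compatible R n \<sigma>"
    and "Sigma_skew_Armendariz R n x \<sigma>"
  shows "skew_Pi_Armendariz R n x"
proof -
  have R: "unital_subring R" and basis: "monomial_basis R n x"
    using assms(1) by (auto simp: skew_PBW_extension_def)
  note closed = unital_subring_closed[OF R]
  note strip = coefficient_mult_eq_0[OF R basis assms(5,6)]
  show ?thesis
    unfolding skew_Pi_Armendariz_def
  proof (intro allI impI, elim conjE)
    fix f g m t a b X Y i j
    assume f: "has_expression R n x f m a X" and g: "has_expression R n x g t b Y"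
      and "f * g \<in> nilpotents UNIV" and i: "i \<le> m" and j: "j \<le> t"
    then obtain k where k: "k > 0" "(f * g) ^ k = 0"
      by (auto simp: nilpotents_def)
    have ab: "a i \<in> R" "b j \<in> R"
      using f g i j by (auto simp: has_expression_def)
    \<comment> \<open>The left factor \<open>r\<close> collects the coefficient pairs already
      extracted, so it has to vary in the induction. For \<open>l = 0\<close> both sides say
      \<open>r = 0\<close>.\<close>
    have powers: "r * (a i * b j) ^ l = 0" if "r \<in> R" "r * (f * g) ^ l = 0" for r l
      using that
    proof (induction l arbitrary: r)
      case (Suc l)
      \<comment> \<open>The leading \<open>f\<close> is split off: \<open>r * f\<close> has the
        coefficients \<open>r * a i\<close>, and everything after it serves as the right
        factor.\<close>
      have "(r * f) * (g * (f * g) ^ l) = 0"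
        using Suc.prems(2) by (simp add: mult.assoc)
      from strip[OF has_expression_left_mult[OF R Suc.prems(1) f] this i]
      have "((r * a i) * g) * (f * g) ^ l = 0"
        by (simp add: mult.assoc)
      \<comment> \<open>The same for the leading \<open>g\<close>, now with \<open>r * a i\<close>
        absorbed into its coefficients; \<open>r * a i * b j\<close> becomes the new left
        factor.\<close>
      from strip[OF has_expression_left_mult[OF R closed(4)[OF Suc.prems(1) ab(1)] g] this j]
      have "(r * a i * b j) * (f * g) ^ l = 0" .
      from Suc.IH[OF _ this] show ?case
        using closed(4) Suc.prems(1) ab by (simp add: mult.assoc)
    qed simp
    have "(a i * b j) ^ k = 0"
      using powers[of 1 k] closed(1) k(2) by simp
    then show "a i * b j \<in> nilpotents R"
      using closed(4) ab k(1) by (auto simp: nilpotents_def)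
  qed
qed

end
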